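(* Let $(P,\preceq)$ be a locally finite lattice and $f:P\to\mathbb{C}$. Let $X=\{x_1,\dots,x_n\}$ and $Y=\{y_1,\dots,y_n\}$ be subsets of $P$, indexed so that $x_i\preceq x_j\Rightarrow i\le j$ and $y_i\preceq y_j\Rightarrow i\le j$. Let $D=\{d_1,\dots,d_m\}$ be any finite subset of $P$ containing all elements $x_i\vee y_j$ ($i,j=1,\dots,n$), indexed so that $d_i\preceq d_j\Rightarrow i\le j$. Then $$[X,Y]_f=E(X)\,\Lambda_{D,f}\,E(Y)^{T}.$$
   Context: $[X,Y]_f$ denotes the $n\times n$ join matrix whose $(i,j)$ entry is $f(x_i\vee y_j)$. For a function $g:P\to\mathbb{C}$, the function $\Psi_{D,g}$ on $D$ is defined recursively by $\Psi_{D,g}(d_k)=g(d_k)-\sum_{d_v\in D,\ d_k\prec d_v}\Psi_{D,g}(d_v)$, equivalently $g(d_k)=\sum_{d_v\in D,\ d_k\preceq d_v}\Psi_{D,g}(d_v)$ for all $k$. $E(X)$ is the $n\times m$ matrix with $(i,j)$ entry $1$ if $x_i\preceq d_j$ and $0$ otherwise; $E(Y)$ is the $n\times m$ matrix with $(i,j)$ entry $1$ if $y_i\preceq d_j$ and $0$ otherwise. $\Lambda_{D,f}=\mathrm{diag}(\Psi_{D,f}(d_1),\dots,\Psi_{D,f}(d_m))$. *)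

theory Defs
  imports Complex_Main "Jordan_Normal_Form.Matrix"
begin

text \<open>
  Matrices of \<^theory>\<open>Jordan_Normal_Form.Matrix\<close> are indexed from 0, so the families
  \<open>x\<^sub>1, \<dots>, x\<^sub>n\<close>, \<open>y\<^sub>1, \<dots>, y\<^sub>n\<close>, \<open>d\<^sub>1, \<dots>, d\<^sub>m\<close> become functions on \<^typ>\<open>nat\<close> of which
  only the values at \<open>0, \<dots>, n - 1\<close> (respectively \<open>0, \<dots>, m - 1\<close>) are used.
\<close>

definition locally_finite_order :: "'a::order itself \<Rightarrow> bool" where
  "locally_finite_order _ \<longleftrightarrow> (\<forall>a b :: 'a. finite {a..b})"

definition join_mat :: "nat \<Rightarrow> (nat \<Rightarrow> 'a::lattice) \<Rightarrow> (nat \<Rightarrow> 'a) \<Rightarrow> ('a \<Rightarrow> complex) \<Rightarrow> complex mat" where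
  "join_mat n x y f = mat n n (\<lambda>(i, j). f (sup (x i) (y j)))"

text \<open>
  The guard \<open>finite D\<close> only serves to make the recursion terminate.
  The equation also assigns values outside \<open>D\<close>, but these are never used.
\<close>

function Psi :: "'a::order set \<Rightarrow> ('a \<Rightarrow> complex) \<Rightarrow> 'a \<Rightarrow> complex" where
  "Psi D g d = (if finite D then g d - (\<Sum>v\<in>{v \<in> D. d < v}. Psi D g v) else 0)"
  by pat_completeness auto

termination Psi
proof (relation "measure (\<lambda>(D, g, d). card {v \<in> D. d < v})", goal_cases)
  case 1
  show ?case by simp
next
  case (2 D g d v)
  then have "{w \<in> D. v < w} \<subset> {w \<in> D. d < w}"
    by (auto intro: less_trans)
  with 2 show ?case
    by (simp add: psubset_card_mono)
qed

declare Psi.simps [simp del]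

lemma Psi_rec:
  "finite D \<Longrightarrow> Psi D g d = g d - (\<Sum>v\<in>{v \<in> D. d < v}. Psi D g v)"
  by (subst Psi.simps) simp

lemma sum_Psi:
  assumes "finite D" "d \<in> D"
  shows "g d = (\<Sum>v\<in>{v \<in> D. d \<le> v}. Psi D g v)"
proof -
  have "{v \<in> D. d \<le> v} = insert d {v \<in> D. d < v}"
    using assms by (auto simp: order.order_iff_strict)
  then show ?thesis
    using assms by (simp add: Psi_rec[of D g d])
qed

definition E_mat :: "nat \<Rightarrow> nat \<Rightarrow> (nat \<Rightarrow> 'a::order) \<Rightarrow> (nat \<Rightarrow> 'a) \<Rightarrow> complex mat" where
  "E_mat n m d x = mat n m (\<lambda>(i, j). if x i \<le> d j then 1 else 0)"

definition Lambda_mat :: "nat \<Rightarrow> (nat \<Rightarrow> 'a::order) \<Rightarrow> ('a \<Rightarrow> complex) \<Rightarrow> complex mat" where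
  "Lambda_mat m d f = mat_diag m (\<lambda>k. Psi (d ` {..<m}) f (d k))"

end

theory Submission
  imports Defs
begin

text \<open>
  The \<open>(i, j)\<close> entry of the product is the sum of \<open>Psi D f v\<close> over all \<open>v \<in> D\<close> above both \<open>x i\<close>
  and \<open>y j\<close>, that is, above \<open>sup (x i) (y j)\<close>. As this join lies in \<open>D\<close>, the recursion defining
  \<open>Psi\<close> evaluates the sum to \<open>f (sup (x i) (y j))\<close>.
\<close>


theorem theorem3p1:
  fixes f :: "'a::lattice \<Rightarrow> complex"
    and x y d :: "nat \<Rightarrow> 'a"
    and n m :: nat
  assumes "locally_finite_order TYPE('a)"
    and "\<And>i j. i < n \<Longrightarrow> j < n \<Longrightarrow> x i \<le> x j \<Longrightarrow> i \<le> j"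
    and "\<And>i j. i < n \<Longrightarrow> j < n \<Longrightarrow> y i \<le> y j \<Longrightarrow> i \<le> j"
    and "\<And>i j. i < m \<Longrightarrow> j < m \<Longrightarrow> d i \<le> d j \<Longrightarrow> i \<le> j"
    and "\<And>i j. i < n \<Longrightarrow> j < n \<Longrightarrow> sup (x i) (y j) \<in> d ` {..<m}"
  shows "join_mat n x y f = E_mat n m d x * Lambda_mat m d f * transpose_mat (E_mat n m d y)"
proof (rule eq_matI)
  let ?R = "E_mat n m d x * Lambda_mat m d f * transpose_mat (E_mat n m d y)"
  let ?D = "d ` {..<m}"
  \<comment> \<open>If \<open>d i = d j\<close>, the ordering of the indices gives both
    \<open>i \<le> j\<close> and \<open>j \<le> i\<close>. Without repetitions in \<open>d\<close>,
    the sum over indices below becomes a sum over \<open>?D\<close>.\<close>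
  have inj: "inj_on d {..<m}"
    using assms(4) by (intro inj_onI) (simp add: order_antisym)
  have E: "E_mat n m d x \<in> carrier_mat n m"
    by (simp add: E_mat_def)
  fix i j
  assume "i < dim_row ?R" "j < dim_col ?R"
  then have ij: "i < n" "j < n"
    by (simp_all add: E_mat_def)
  have "?R $$ (i, j) =
      (\<Sum>k<m. if sup (x i) (y j) \<le> d k then Psi ?D f (d k) else 0)"
    \<comment> \<open>The diagonal factor only scales columns, so a single sum over \<open>k\<close>
      remains; the two 0-1 entries multiply to the indicator of
      \<open>sup (x i) (y j) \<le> d k\<close>.\<close>
    unfolding Lambda_mat_def mat_diag_mult_right[OF E] using ij
    by (auto simp: E_mat_def scalar_prod_def lessThan_atLeast0 intro!: sum.cong)
  also have "\<dots> = (\<Sum>v\<in>?D. if sup (x i) (y j) \<le> v then Psi ?D f v else 0)"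
    by (simp add: sum.reindex[OF inj])
  also have "\<dots> = (\<Sum>v\<in>{v \<in> ?D. sup (x i) (y j) \<le> v}. Psi ?D f v)"
    by (rule sum.inter_filter[symmetric]) simp
  also have "\<dots> = f (sup (x i) (y j))"
    using assms(5)[OF ij] by (intro sum_Psi[symmetric]) simp_all
  finally show "join_mat n x y f $$ (i, j) = ?R $$ (i, j)"
    using ij by (simp add: join_mat_def)
qed (simp_all add: join_mat_def E_mat_def)

end
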